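(* For every $\alpha\in(0,1]$ and $\beta>0$ there is a constant $C(\alpha,\beta)$, depending only on $\alpha$ and $\beta$, such that for all non-negative $f\in\mathcal{F}^\beta([0,1])$, $$\|f^\alpha\|_{C^{\alpha\beta}([0,1])}\le \|f^\alpha\|_{\mathcal{F}^{\alpha\beta}([0,1])}\le C(\alpha,\beta)\,\|f\|_{\mathcal{F}^\beta([0,1])}^\alpha .$$
   Context: For $\beta>0$, $\lfloor\beta\rfloor$ denotes the largest integer strictly smaller than $\beta$ (so $\lfloor 1\rfloor=0$). For $\Omega\subset\mathbb{R}$ let $$|f|_{C^\beta(\Omega)}=\sup_{x\ne y,\;x,y\in\Omega}\frac{|f^{(\lfloor\beta\rfloor)}(x)-f^{(\lfloor\beta\rfloor)}(y)|}{|x-y|^{\beta-\lfloor\beta\rfloor}},\qquad \|f\|_{C^\beta(\Omega)}=\|f\|_\infty+\|f^{(\lfloor\beta\rfloor)}\|_\infty+|f|_{C^\beta(\Omega)},$$ and $C^\beta(\Omega)=\{f:\Omega\to\mathbb{R}: f^{(\lfloor\beta\rfloor)}\text{ exists},\ \|f\|_{C^\beta(\Omega)}<\infty\}$ (derivatives at endpoints of an interval are one-sided). For $f\in C^\beta([0,1])$, $f\ge 0$, define $|f|_{\mathcal{F}^\beta}$ as the infimum over all real $\kappa\ge0$ such that $$|f^{(j)}(x)|^\beta\le \kappa^j|f(x)|^{\beta-j}\quad\text{for all }x\in[0,1]\text{ and all integers }1\le j<\beta,$$ with $|f|_{\mathcal{F}^\beta}=\infty$ if no such $\kappa$ exists,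 and $|f|_{\mathcal{F}^\beta}=0$ for $\beta\le1$. Set $\|f\|_{\mathcal{F}^\beta}=\|f\|_{\mathcal{F}^\beta([0,1])}=\|f\|_{C^\beta([0,1])}+|f|_{\mathcal{F}^\beta}$ and $\mathcal{F}^\beta=\mathcal{F}^\beta([0,1])=\{f\in C^\beta([0,1]): f\ge0,\ \|f\|_{\mathcal{F}^\beta}<\infty\}$. The function $f^\alpha$ is $x\mapsto f(x)^\alpha\geq 0$. *)

theory Defs
  imports "HOL-Analysis.Analysis"
begin

(* The largest integer strictly smaller than b (for b > 0), so strict_floor 1 = 0. *)
definition strict_floor :: "real \<Rightarrow> nat" where
  "strict_floor b = nat (\<lceil>b\<rceil> - 1)"

lemma le_strict_floor_iff:
  assumes "b > 0"
  shows "k \<le> strict_floor b \<longleftrightarrow> real k < b"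
  using assms unfolding strict_floor_def by linarith

(* Derivatives are taken within S, hence one-sided at the endpoints of an interval;
   values of f outside S play no role. *)
definition deriv_within :: "real set \<Rightarrow> nat \<Rightarrow> (real \<Rightarrow> real) \<Rightarrow> real \<Rightarrow> real" where
  "deriv_within S j f = ((\<lambda>g x. vector_derivative g (at x within S)) ^^ j) f"

definition times_differentiable_on :: "nat \<Rightarrow> (real \<Rightarrow> real) \<Rightarrow> real set \<Rightarrow> bool" where
  "times_differentiable_on n f S \<longleftrightarrow>
     (\<forall>j<n. \<forall>x\<in>S. deriv_within S j f differentiable (at x within S))"

definition sup_norm :: "real set \<Rightarrow> (real \<Rightarrow> real) \<Rightarrow> ennreal" where
  "sup_norm S f = (SUP x\<in>S. ennreal \<bar>f x\<bar>)"

definition holder_seminorm :: "real set \<Rightarrow> real \<Rightarrow> (real \<Rightarrow> real) \<Rightarrow> ennreal" where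
  "holder_seminorm S b f =
     (let n = strict_floor b in
      SUP (x, y) \<in> {(x, y). x \<in> S \<and> y \<in> S \<and> x \<noteq> y}.
        ennreal (\<bar>deriv_within S n f x - deriv_within S n f y\<bar> / \<bar>x - y\<bar> powr (b - real n)))"

definition holder_norm :: "real set \<Rightarrow> real \<Rightarrow> (real \<Rightarrow> real) \<Rightarrow> ennreal" where
  "holder_norm S b f =
     sup_norm S f + sup_norm S (deriv_within S (strict_floor b) f) + holder_seminorm S b f"

definition holder_space :: "real set \<Rightarrow> real \<Rightarrow> (real \<Rightarrow> real) set" where
  "holder_space S b =
     {f. times_differentiable_on (strict_floor b) f S \<and> holder_norm S b f < \<infinity>}"

(* The infimum over the empty set is \<infinity> in ennreal. *)
definition flat_seminorm :: "real \<Rightarrow> (real \<Rightarrow> real) \<Rightarrow> ennreal" where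
  "flat_seminorm b f =
     Inf {ennreal \<kappa> | \<kappa>. \<kappa> \<ge> 0 \<and>
       (\<forall>x\<in>{0..1}. \<forall>j::nat. 1 \<le> j \<and> real j < b \<longrightarrow>
          \<bar>deriv_within {0..1} j f x\<bar> powr b \<le> \<kappa> ^ j * \<bar>f x\<bar> powr (b - real j))}"

(* For b \<le> 1 the condition on \<kappa> is vacuous, so no separate case is needed. *)
lemma flat_seminorm_le_1:
  assumes "b \<le> 1"
  shows "flat_seminorm b f = 0"
proof -
  have "flat_seminorm b f \<le> ennreal 0"
    unfolding flat_seminorm_def
    by (rule Inf_lower) (use assms in \<open>auto intro!: exI[of _ "0::real"]\<close>)
  then show ?thesis by simp
qed

definition flat_norm :: "real \<Rightarrow> (real \<Rightarrow> real) \<Rightarrow> ennreal" where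
  "flat_norm b f = holder_norm {0..1} b f + flat_seminorm b f"

definition flat_space :: "real \<Rightarrow> (real \<Rightarrow> real) set" where
  "flat_space b =
     {f \<in> holder_space {0..1} b. (\<forall>x\<in>{0..1}. f x \<ge> 0) \<and> flat_norm b f < \<infinity>}"

end

theory Submission
  imports Defs
begin

text \<open>
  Let \<open>K\<close> exceed \<open>flat_norm \<beta> f\<close> and divide \<open>f\<close> by \<open>K\<close>, so that all constants in the hypotheses
  become \<open>1\<close>. For \<open>\<beta> \<le> 1\<close> no derivative occurs and the theorem is the inequality
  \<open>\<bar>a\<^sup>\<alpha> - b\<^sup>\<alpha>\<bar> \<le> \<bar>a - b\<bar>\<^sup>\<alpha>\<close>.

  Let \<open>\<beta> > 1\<close>. The flatness condition says that at a point where \<open>f\<close> is small the derivatives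
  of \<open>f\<close> are as small as if \<open>f\<close> were the \<open>\<beta>\<close>-th power of a distance. This is made literal by the
  gauge \<open>u = f\<^bsup>1/\<beta>\<^esup>\<close>: the condition on \<open>f'\<close> alone makes \<open>u\<close> Lipschitz with constant \<open>1\<close>
  (\<open>root_Lipschitz\<close>), so \<open>u\<close> is comparable to \<open>u x\<close> on the interval of radius \<open>u x / 2\<close> around \<open>x\<close>,
  and the flatness condition reads \<open>\<bar>f\<^bsup>(j)\<^esup>\<bar> \<le> u\<^bsup>\<beta>-j\<^esup>\<close>.

  Say that \<open>g\<close>, defined where \<open>u > 0\<close>, has weight \<open>p\<close> to order \<open>r\<close> if \<open>\<bar>g\<^bsup>(j)\<^esup>\<bar> \<le> M u\<^bsup>p-j\<^esup>\<close>
  for \<open>j \<le> r\<close> and \<open>g\<^bsup>(r)\<^esup>\<close> satisfies the Hoelder condition of the same homogeneity on those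
  intervals. Weights add under multiplication (\<open>weighted_mult\<close>) and drop by one under
  differentiation. Now \<open>f = u\<^sup>\<beta>\<close> has weight \<open>\<beta>\<close>, and \<open>(u\<^sup>q)' = (q/\<beta>) u\<^bsup>q-\<beta>\<^esup> f'\<close>, so that induction on the
  order gives every power \<open>u\<^sup>q\<close> weight \<open>q\<close> (\<open>weighted_gauge_powr\<close>).

  In particular \<open>f\<^sup>\<alpha> = u\<^bsup>\<alpha>\<beta>\<^esup>\<close> has weight \<open>\<alpha>\<beta>\<close>, which is the flatness condition for \<open>f\<^sup>\<alpha>\<close> where
  \<open>f > 0\<close>. At a zero of \<open>u\<close> the formal derivatives of order \<open>j < \<alpha>\<beta> - 1\<close> are
  \<open>O(\<bar>x - x\<^sub>0\<bar>\<^bsup>\<alpha>\<beta>-j\<^esup>)\<close>, with exponent above \<open>1\<close>; hence extending them by \<open>0\<close> again gives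
  derivatives. For the global Hoelder condition on the highest derivative let \<open>u y \<le> u x\<close>. If
  \<open>\<bar>x - y\<bar> \<le> u x / 2\<close>, it is the local condition; otherwise \<open>u x < 2 \<bar>x - y\<bar>\<close> and the bounds for the
  two values suffice (\<open>weighted_extend_by_zero\<close>). Finally \<open>K\<close> decreases to the norm of \<open>f\<close>.
\<close>

section \<open>Real powers\<close>

lemma powr_interpolate:
  fixes d a s t :: real
  assumes "0 \<le> d" "d \<le> a" "s \<le> t"
  shows "d powr t \<le> d powr s * a powr (t - s)"
proof -
  have "d powr t = d powr s * d powr (t - s)"
    by (simp flip: powr_add)
  also have "\<dots> \<le> d powr s * a powr (t - s)"
    using assms by (intro mult_left_mono powr_mono2) auto
  finally show ?thesis .
qed

lemma powr_comparable:
  fixes a b p :: real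
  assumes "0 < a" "a / 2 \<le> b" "b \<le> 2 * a"
  shows "b powr p \<le> 2 powr \<bar>p\<bar> * a powr p"
proof (cases "0 \<le> p")
  case True
  then have "b powr p \<le> (2 * a) powr p"
    using assms by (intro powr_mono2) auto
  with True assms show ?thesis by (simp add: powr_mult)
next
  case False
  then have "b powr p \<le> (a / 2) powr p"
    using assms by (intro powr_mono2') auto
  also have "\<dots> = a powr p * inverse (2 powr p)"
    by (simp only: powr_divide) (rule divide_inverse)
  also have "inverse (2 powr p) = (2::real) powr (- p)"
    by (rule powr_minus[symmetric])
  also have "- p = \<bar>p\<bar>"
    using False by simp
  finally show ?thesis by (simp only: mult.commute)
qed

lemma abs_powr_diff_le:
  fixes a b \<alpha> :: real
  assumes "0 \<le> a" "0 \<le> b" "0 < \<alpha>" "\<alpha> \<le> 1"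
  shows "\<bar>a powr \<alpha> - b powr \<alpha>\<bar> \<le> \<bar>a - b\<bar> powr \<alpha>"
proof -
  (* Subadditivity: t powr \<alpha> is at least t for the shares t of x and y in x + y. *)
  have sub: "(x + y) powr \<alpha> \<le> x powr \<alpha> + y powr \<alpha>" if "0 \<le> x" "0 \<le> y" for x y :: real
  proof (cases "x + y = 0")
    case True
    with that show ?thesis by simp
  next
    case False
    with that have pos: "0 < x + y" by simp
    have *: "z / (x + y) \<le> (z / (x + y)) powr \<alpha>" if "0 \<le> z" "z \<le> x + y" for z
      using powr_mono'[of \<alpha> 1 "z / (x + y)"] that pos assms by simp
    have "1 = x / (x + y) + y / (x + y)"
      using pos by (simp flip: add_divide_distrib)
    also have "\<dots> \<le> (x / (x + y)) powr \<alpha> + (y / (x + y)) powr \<alpha>"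
      using that by (intro add_mono *) auto
    also have "\<dots> = (x powr \<alpha> + y powr \<alpha>) / (x + y) powr \<alpha>"
      using that pos by (simp add: powr_divide add_divide_distrib)
    finally show ?thesis
      using pos by (simp add: pos_le_divide_eq)
  qed
  show ?thesis
  proof (cases "a \<le> b")
    case True
    then have "b powr \<alpha> \<le> a powr \<alpha> + (b - a) powr \<alpha>" "a powr \<alpha> \<le> b powr \<alpha>"
      using sub[of a "b - a"] assms by (simp_all add: powr_mono2)
    with True show ?thesis by (simp add: abs_if)
  next
    case False
    then have "a powr \<alpha> \<le> b powr \<alpha> + (a - b) powr \<alpha>" "b powr \<alpha> \<le> a powr \<alpha>"
      using sub[of b "a - b"] assms by (simp_all add: powr_mono2)
    with False show ?thesis by (simp add: abs_if)
  qed
qed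

lemma has_real_derivative_powr_within:
  fixes g :: "real \<Rightarrow> real"
  assumes "(g has_real_derivative g') (at x within S)" "0 < g x"
  shows "((\<lambda>x. g x powr r) has_real_derivative r * g x powr (r - 1) * g') (at x within S)"
  using DERIV_chain2[OF has_real_derivative_powr[OF assms(2)] assms(1)] .

section \<open>Functions of prescribed weight relative to a Lipschitz gauge\<close>

text \<open>
  Derivatives are carried along as a sequence of functions, because near the zeros of \<open>f\<close>
  a candidate for each derivative of \<open>f\<^sup>\<alpha>\<close> is written down before it is known to be one.
\<close>

definition is_jet :: "nat \<Rightarrow> (nat \<Rightarrow> real \<Rightarrow> real) \<Rightarrow> bool" where
  "is_jet n F \<longleftrightarrow> (\<forall>j<n. \<forall>x\<in>{0..1}. (F j has_real_derivative F (Suc j) x) (at x within {0..1}))"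

text \<open>
  The constants have to be the same for all functions \<open>f\<close> that are considered. Therefore every
  notion speaks of families indexed by \<open>I\<close>, with constants that are independent of the index;
  in the application the index is the normalised function with its derivatives. A constant that exists
  for one family is then automatically uniform, and need not be computed.
\<close>

locale gauge_family =
  fixes I :: "'i set" and u :: "'i \<Rightarrow> real \<Rightarrow> real" and s :: real
  assumes s_pos: "0 < s" and s_le_1: "s \<le> 1"
    and gauge_nonneg: "\<And>i x. u i x \<ge> 0"
    and gauge_Lipschitz:
      "\<And>i x y. i \<in> I \<Longrightarrow> x \<in> {0..1} \<Longrightarrow> y \<in> {0..1} \<Longrightarrow> \<bar>u i x - u i y\<bar> \<le> \<bar>x - y\<bar>"
begin

definition dominated_by :: "real \<Rightarrow> real \<Rightarrow> ('i \<Rightarrow> real \<Rightarrow> real) \<Rightarrow> bool" where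
  "dominated_by M p g \<longleftrightarrow> M \<ge> 0 \<and>
     (\<forall>i\<in>I. \<forall>x\<in>{0..1}. 0 < u i x \<longrightarrow> \<bar>g i x\<bar> \<le> M * u i x powr p)"

text \<open>
  The exponent \<open>p - s\<close> is the one for which \<open>u\<^sup>p\<close> itself qualifies. The radius \<open>u i x / 2\<close> keeps
  the segment from \<open>x\<close> to \<open>y\<close> inside the region where \<open>u\<close> is comparable to \<open>u i x\<close>.
\<close>

definition holder_by :: "real \<Rightarrow> real \<Rightarrow> ('i \<Rightarrow> real \<Rightarrow> real) \<Rightarrow> bool" where
  "holder_by M p g \<longleftrightarrow> M \<ge> 0 \<and>
     (\<forall>i\<in>I. \<forall>x\<in>{0..1}. \<forall>y\<in>{0..1}. 0 < u i x \<longrightarrow> \<bar>x - y\<bar> \<le> u i x / 2 \<longrightarrow>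
        \<bar>g i x - g i y\<bar> \<le> M * u i x powr (p - s) * \<bar>x - y\<bar> powr s)"

definition dominated :: "real \<Rightarrow> ('i \<Rightarrow> real \<Rightarrow> real) \<Rightarrow> bool" where
  "dominated p g \<longleftrightarrow> (\<exists>M. dominated_by M p g)"

definition locally_holder :: "real \<Rightarrow> ('i \<Rightarrow> real \<Rightarrow> real) \<Rightarrow> bool" where
  "locally_holder p g \<longleftrightarrow> (\<exists>M. holder_by M p g)"

definition has_family_derivative ::
    "('i \<Rightarrow> real \<Rightarrow> real) \<Rightarrow> ('i \<Rightarrow> real \<Rightarrow> real) \<Rightarrow> bool" where
  "has_family_derivative g g' \<longleftrightarrow> (\<forall>i\<in>I. \<forall>x\<in>{0..1}. 0 < u i x \<longrightarrow>
     (g i has_real_derivative g' i x) (at x within {0..1}))"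

text \<open>
  The Hoelder condition is only asked of the highest derivative; for the lower ones it
  follows from the bound on the next derivative (\<open>locally_holder_of_derivative\<close>).
\<close>

primrec weighted :: "nat \<Rightarrow> real \<Rightarrow> ('i \<Rightarrow> real \<Rightarrow> real) \<Rightarrow> bool" where
  "weighted 0 p g \<longleftrightarrow> dominated p g \<and> locally_holder p g"
| "weighted (Suc r) p g \<longleftrightarrow>
     dominated p g \<and> (\<exists>g'. has_family_derivative g g' \<and> weighted r (p - 1) g')"

lemma dominated_byD:
  assumes "dominated_by M p g"
  shows "M \<ge> 0"
    "i \<in> I \<Longrightarrow> x \<in> {0..1} \<Longrightarrow> 0 < u i x \<Longrightarrow> \<bar>g i x\<bar> \<le> M * u i x powr p"
  using assms unfolding dominated_by_def by (blast, blast)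

lemma dominatedI:
  assumes "M \<ge> 0"
    "\<And>i x. i \<in> I \<Longrightarrow> x \<in> {0..1} \<Longrightarrow> 0 < u i x \<Longrightarrow> \<bar>g i x\<bar> \<le> M * u i x powr p"
  shows "dominated p g"
  unfolding dominated_def dominated_by_def
  using assms by (intro exI[of _ M] conjI ballI impI)

lemma holder_byD:
  assumes "holder_by M p g"
  shows "M \<ge> 0"
    "i \<in> I \<Longrightarrow> x \<in> {0..1} \<Longrightarrow> y \<in> {0..1} \<Longrightarrow> 0 < u i x \<Longrightarrow> \<bar>x - y\<bar> \<le> u i x / 2 \<Longrightarrow>
      \<bar>g i x - g i y\<bar> \<le> M * u i x powr (p - s) * \<bar>x - y\<bar> powr s"
  using assms unfolding holder_by_def by (blast, blast)

lemma locally_holderI: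
  assumes "M \<ge> 0"
    "\<And>i x y. i \<in> I \<Longrightarrow> x \<in> {0..1} \<Longrightarrow> y \<in> {0..1} \<Longrightarrow> 0 < u i x \<Longrightarrow> \<bar>x - y\<bar> \<le> u i x / 2 \<Longrightarrow>
      \<bar>g i x - g i y\<bar> \<le> M * u i x powr (p - s) * \<bar>x - y\<bar> powr s"
  shows "locally_holder p g"
  unfolding locally_holder_def holder_by_def
  using assms by (intro exI[of _ M] conjI ballI impI)

lemma has_family_derivativeD:
  "has_family_derivative g g' \<Longrightarrow> i \<in> I \<Longrightarrow> x \<in> {0..1} \<Longrightarrow> 0 < u i x \<Longrightarrow>
    (g i has_real_derivative g' i x) (at x within {0..1})"
  unfolding has_family_derivative_def by simp

lemma weighted_imp_dominated: "weighted r p g \<Longrightarrow> dominated p g"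
  by (cases r) auto

lemma gauge_comparable:
  assumes "i \<in> I" "x \<in> {0..1}" "y \<in> {0..1}" "\<bar>x - y\<bar> \<le> u i x / 2"
  shows "u i x / 2 \<le> u i y" "u i y \<le> 2 * u i x"
  using gauge_Lipschitz[OF assms(1-3)] gauge_nonneg[of i x] assms(4) by linarith+

lemma gauge_powr_comparable:
  assumes "i \<in> I" "x \<in> {0..1}" "y \<in> {0..1}" "0 < u i x" "\<bar>x - y\<bar> \<le> u i x / 2"
  shows "u i y powr p \<le> 2 powr \<bar>p\<bar> * u i x powr p"
  using powr_comparable[OF assms(4) gauge_comparable[OF assms(1-3,5)]] .

text \<open>
  Within distance \<open>u i x / 2\<close> a Lipschitz bound of the correct homogeneity is stronger than a Hoelder
  bound, since \<open>\<bar>x - y\<bar>\<^bsup>1-s\<^esup> \<le> (u i x)\<^bsup>1-s\<^esup>\<close>.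
\<close>

lemma Lipschitz_imp_holder_step:
  assumes "0 < u i x" "\<bar>x - y\<bar> \<le> u i x / 2" "0 \<le> M"
  shows "M * u i x powr (p - 1) * \<bar>x - y\<bar> \<le> M * u i x powr (p - s) * \<bar>x - y\<bar> powr s"
proof -
  have "\<bar>x - y\<bar> powr 1 \<le> \<bar>x - y\<bar> powr s * u i x powr (1 - s)"
    using assms s_le_1 by (intro powr_interpolate) auto
  then have "\<bar>x - y\<bar> \<le> \<bar>x - y\<bar> powr s * u i x powr (1 - s)"
    by simp
  then have "M * u i x powr (p - 1) * \<bar>x - y\<bar>
      \<le> M * u i x powr (p - 1) * (\<bar>x - y\<bar> powr s * u i x powr (1 - s))"
    using assms by (intro mult_left_mono) auto
  also have "\<dots> = M * (u i x powr (p - 1) * u i x powr (1 - s)) * \<bar>x - y\<bar> powr s"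
    by (simp add: mult_ac)
  also have "u i x powr (p - 1) * u i x powr (1 - s) = u i x powr (p - s)"
    by (simp flip: powr_add)
  finally show ?thesis .
qed

text \<open>
  This is the mean value inequality on the segment between \<open>x\<close> and \<open>y\<close>, where the bound on the
  derivative changes only by a constant factor.
\<close>

lemma locally_holder_of_derivative:
  assumes der: "has_family_derivative g g'" and dom: "dominated (p - 1) g'"
  shows "locally_holder p g"
proof -
  from dom obtain M where M_by: "dominated_by M (p - 1) g'"
    unfolding dominated_def by blast
  note M = dominated_byD[OF M_by]
  define L where "L = M * 2 powr \<bar>p - 1\<bar>"
  have L: "L \<ge> 0" using M(1) by (simp add: L_def)
  have "\<bar>g i x - g i y\<bar> \<le> L * u i x powr (p - s) * \<bar>x - y\<bar> powr s"
    if *: "i \<in> I" "x \<in> {0..1}" "y \<in> {0..1}" "0 < u i x" "\<bar>x - y\<bar> \<le> u i x / 2" for i x y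
  proof -
    have seg: "z \<in> {0..1} \<and> \<bar>x - z\<bar> \<le> u i x / 2" if "z \<in> closed_segment x y" for z
      using that * by (auto simp: closed_segment_eq_real_ivl split: if_splits)
    have "norm (g i x - g i y) \<le> (L * u i x powr (p - 1)) * norm (x - y)"
    proof (rule field_differentiable_bound)
      fix z assume "z \<in> closed_segment x y"
      with seg have z: "z \<in> {0..1}" "\<bar>x - z\<bar> \<le> u i x / 2" by auto
      have pos: "0 < u i z"
        using gauge_comparable(1)[OF *(1,2) z] *(4) by linarith
      show "(g i has_real_derivative g' i z) (at z within closed_segment x y)"
        using seg by (intro DERIV_subset[OF has_family_derivativeD[OF der *(1) z(1) pos]]) blast
      have "\<bar>g' i z\<bar> \<le> M * u i z powr (p - 1)"
        by (intro M(2) *(1) z(1) pos)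
      also have "\<dots> \<le> M * (2 powr \<bar>p - 1\<bar> * u i x powr (p - 1))"
        using M(1) gauge_powr_comparable[OF *(1,2) z(1) *(4) z(2)] by (intro mult_left_mono)
      finally show "norm (g' i z) \<le> L * u i x powr (p - 1)"
        by (simp add: L_def mult_ac)
    qed auto
    then have "\<bar>g i x - g i y\<bar> \<le> L * u i x powr (p - 1) * \<bar>x - y\<bar>"
      by simp
    also have "\<dots> \<le> L * u i x powr (p - s) * \<bar>x - y\<bar> powr s"
      by (rule Lipschitz_imp_holder_step[OF *(4,5) L])
    finally show ?thesis .
  qed
  with L show ?thesis by (rule locally_holderI)
qed

lemma weighted_Suc_imp: "weighted (Suc r) p g \<Longrightarrow> weighted r p g"
proof (induction r arbitrary: p g)
  case 0
  then show ?case by (auto intro: locally_holder_of_derivative)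
next
  case (Suc r)
  then show ?case by (metis weighted.simps(2))
qed

lemma dominated_add:
  assumes "dominated p g" "dominated p h"
  shows "dominated p (\<lambda>i x. g i x + h i x)"
proof -
  from assms(1) obtain M where M_by: "dominated_by M p g"
    unfolding dominated_def by blast
  note M = dominated_byD[OF M_by]
  from assms(2) obtain N where N_by: "dominated_by N p h"
    unfolding dominated_def by blast
  note N = dominated_byD[OF N_by]
  have "\<bar>g i x + h i x\<bar> \<le> (M + N) * u i x powr p"
    if "i \<in> I" "x \<in> {0..1}" "0 < u i x" for i x
    using M(2)[OF that] N(2)[OF that] by (simp add: distrib_right)
  with M(1) N(1) show ?thesis by (intro dominatedI[of "M + N"]) auto
qed

lemma locally_holder_add:
  assumes "locally_holder p g" "locally_holder p h"
  shows "locally_holder p (\<lambda>i x. g i x + h i x)"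
proof -
  from assms(1) obtain M where M_by: "holder_by M p g"
    unfolding locally_holder_def by blast
  note M = holder_byD[OF M_by]
  from assms(2) obtain N where N_by: "holder_by N p h"
    unfolding locally_holder_def by blast
  note N = holder_byD[OF N_by]
  have "\<bar>(g i x + h i x) - (g i y + h i y)\<bar> \<le> (M + N) * u i x powr (p - s) * \<bar>x - y\<bar> powr s"
    if "i \<in> I" "x \<in> {0..1}" "y \<in> {0..1}" "0 < u i x" "\<bar>x - y\<bar> \<le> u i x / 2" for i x y
    using M(2)[OF that] N(2)[OF that] by (simp add: distrib_right)
  with M(1) N(1) show ?thesis by (intro locally_holderI[of "M + N"]) auto
qed

lemma weighted_add:
  "weighted r p g \<Longrightarrow> weighted r p h \<Longrightarrow> weighted r p (\<lambda>i x. g i x + h i x)"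
proof (induction r arbitrary: p g h)
  case 0
  then show ?case by (simp add: dominated_add locally_holder_add)
next
  case (Suc r)
  then obtain g' h' where g': "has_family_derivative g g'" "weighted r (p - 1) g'"
    and h': "has_family_derivative h h'" "weighted r (p - 1) h'"
    by auto
  have "has_family_derivative (\<lambda>i x. g i x + h i x) (\<lambda>i x. g' i x + h' i x)"
    using g'(1) h'(1) unfolding has_family_derivative_def by (auto intro!: DERIV_add)
  with Suc.IH[OF g'(2) h'(2)] Suc.prems show ?case
    by (auto intro: dominated_add)
qed

lemma dominated_mult:
  assumes "dominated p g" "dominated q h"
  shows "dominated (p + q) (\<lambda>i x. g i x * h i x)"
proof -
  from assms(1) obtain M where M_by: "dominated_by M p g"
    unfolding dominated_def by blast
  note M = dominated_byD[OF M_by]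
  from assms(2) obtain N where N_by: "dominated_by N q h"
    unfolding dominated_def by blast
  note N = dominated_byD[OF N_by]
  have "\<bar>g i x * h i x\<bar> \<le> M * N * u i x powr (p + q)"
    if "i \<in> I" "x \<in> {0..1}" "0 < u i x" for i x
    using mult_mono[OF M(2)[OF that] N(2)[OF that]] M(1)
    by (simp add: abs_mult powr_add mult_ac)
  with M(1) N(1) show ?thesis by (intro dominatedI[of "M * N"]) auto
qed

lemma locally_holder_mult:
  assumes "dominated p g" "locally_holder p g" "dominated q h" "locally_holder q h"
  shows "locally_holder (p + q) (\<lambda>i x. g i x * h i x)"
proof -
  from assms(1) obtain M where M_by: "dominated_by M p g"
    unfolding dominated_def by blast
  note M = dominated_byD[OF M_by]
  from assms(3) obtain N where N_by: "dominated_by N q h"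
    unfolding dominated_def by blast
  note N = dominated_byD[OF N_by]
  from assms(2) obtain M' where M'_by: "holder_by M' p g"
    unfolding locally_holder_def by blast
  note M' = holder_byD[OF M'_by]
  from assms(4) obtain N' where N'_by: "holder_by N' q h"
    unfolding locally_holder_def by blast
  note N' = holder_byD[OF N'_by]
  define L where "L = M * N' + M' * (N * 2 powr \<bar>q\<bar>)"
  have L: "L \<ge> 0" using M(1) N(1) M'(1) N'(1) by (simp add: L_def)
  have "\<bar>g i x * h i x - g i y * h i y\<bar> \<le> L * u i x powr (p + q - s) * \<bar>x - y\<bar> powr s"
    if *: "i \<in> I" "x \<in> {0..1}" "y \<in> {0..1}" "0 < u i x" "\<bar>x - y\<bar> \<le> u i x / 2" for i x y
  proof -
    have pos: "0 < u i y"
      using gauge_comparable(1)[OF *(1-3,5)] *(4) by linarith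
    have "\<bar>h i y\<bar> \<le> N * u i y powr q"
      by (intro N(2) *(1,3) pos)
    also have "\<dots> \<le> N * (2 powr \<bar>q\<bar> * u i x powr q)"
      using N(1) gauge_powr_comparable[OF *] by (intro mult_left_mono)
    finally have hy: "\<bar>h i y\<bar> \<le> N * (2 powr \<bar>q\<bar> * u i x powr q)" .
    have "g i x * h i x - g i y * h i y = g i x * (h i x - h i y) + (g i x - g i y) * h i y"
      by (simp add: algebra_simps)
    also have "\<bar>\<dots>\<bar> \<le> \<bar>g i x\<bar> * \<bar>h i x - h i y\<bar> + \<bar>g i x - g i y\<bar> * \<bar>h i y\<bar>"
      by (metis abs_mult abs_triangle_ineq)
    also have "\<dots> \<le> (M * u i x powr p) * (N' * u i x powr (q - s) * \<bar>x - y\<bar> powr s)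
        + (M' * u i x powr (p - s) * \<bar>x - y\<bar> powr s) * (N * (2 powr \<bar>q\<bar> * u i x powr q))"
      by (rule add_mono[OF mult_mono[OF M(2)[OF *(1,2,4)] N'(2)[OF *]]
            mult_mono[OF M'(2)[OF *] hy]]) (use M(1) M'(1) in auto)
    also have "\<dots> = M * N' * (u i x powr p * u i x powr (q - s)) * \<bar>x - y\<bar> powr s
        + M' * (N * 2 powr \<bar>q\<bar>) * (u i x powr (p - s) * u i x powr q) * \<bar>x - y\<bar> powr s"
      by (simp add: mult_ac)
    also have "u i x powr p * u i x powr (q - s) = u i x powr (p + q - s)"
      by (simp add: add_diff_eq flip: powr_add)
    also have "u i x powr (p - s) * u i x powr q = u i x powr (p + q - s)"
      by (simp add: diff_add_eq flip: powr_add)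
    finally show ?thesis by (simp add: L_def distrib_right)
  qed
  with L show ?thesis by (rule locally_holderI)
qed

text \<open>
  The product rule expresses the derivative as a sum of two products of total weight
  \<open>p + q - 1\<close>; in each, one factor is undifferentiated and has one order to spare.
\<close>

lemma weighted_mult:
  "weighted r p g \<Longrightarrow> weighted r q h \<Longrightarrow> weighted r (p + q) (\<lambda>i x. g i x * h i x)"
proof (induction r arbitrary: p q g h)
  case 0
  then show ?case by (simp add: dominated_mult locally_holder_mult)
next
  case (Suc r)
  then obtain g' h' where g': "has_family_derivative g g'" "weighted r (p - 1) g'"
    and h': "has_family_derivative h h'" "weighted r (q - 1) h'"
    by auto
  have der: "has_family_derivative (\<lambda>i x. g i x * h i x) (\<lambda>i x. g' i x * h i x + g i x * h' i x)"
    using g'(1) h'(1) unfolding has_family_derivative_def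
    by (auto intro!: derivative_eq_intros simp: mult_ac)
  have "weighted r (p - 1 + q) (\<lambda>i x. g' i x * h i x)"
    using g'(2) weighted_Suc_imp[OF Suc.prems(2)] by (rule Suc.IH)
  moreover have "weighted r (p + (q - 1)) (\<lambda>i x. g i x * h' i x)"
    using weighted_Suc_imp[OF Suc.prems(1)] h'(2) by (rule Suc.IH)
  ultimately have "weighted r (p + q - 1) (\<lambda>i x. g' i x * h i x + g i x * h' i x)"
    by (intro weighted_add) (simp_all add: algebra_simps)
  with der dominated_mult Suc.prems[THEN weighted_imp_dominated] show ?case
    by auto
qed

lemma weighted_const: "weighted r 0 (\<lambda>i x. c)"
proof -
  have zero: "weighted r p (\<lambda>i x. 0)" for p
  proof (induction r arbitrary: p)
    case 0
    then show ?case by (auto intro: dominatedI[of 0] locally_holderI[of 0])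
  next
    case (Suc r)
    have "has_family_derivative (\<lambda>i x. 0) (\<lambda>i x. 0)"
      by (simp add: has_family_derivative_def)
    with Suc show ?case
      by (auto intro: dominatedI[of 0])
  qed
  have dom: "dominated 0 (\<lambda>i x. c)"
    by (rule dominatedI[of "\<bar>c\<bar>"]) auto
  have der: "has_family_derivative (\<lambda>i x. c) (\<lambda>i x. 0)"
    by (simp add: has_family_derivative_def)
  have "weighted (Suc r) 0 (\<lambda>i x. c)"
    using dom der zero by auto
  then show ?thesis by (rule weighted_Suc_imp)
qed

lemma dominated_gauge_powr: "dominated q (\<lambda>i x. u i x powr q)"
  by (rule dominatedI[of 1]) auto

text \<open>
  Here the mean value inequality is applied to \<open>z \<mapsto> z\<^sup>q\<close> between \<open>u i x\<close> and \<open>u i y\<close>: the gauge need not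
  be differentiable.
\<close>

lemma locally_holder_gauge_powr: "locally_holder q (\<lambda>i x. u i x powr q)"
proof -
  define L where "L = \<bar>q\<bar> * 2 powr \<bar>q - 1\<bar>"
  have L: "L \<ge> 0" by (simp add: L_def)
  have "\<bar>u i x powr q - u i y powr q\<bar> \<le> L * u i x powr (q - s) * \<bar>x - y\<bar> powr s"
    if *: "i \<in> I" "x \<in> {0..1}" "y \<in> {0..1}" "0 < u i x" "\<bar>x - y\<bar> \<le> u i x / 2" for i x y
  proof -
    have "norm (u i x powr q - u i y powr q) \<le> (L * u i x powr (q - 1)) * norm (u i x - u i y)"
    proof (rule field_differentiable_bound)
      fix z assume "z \<in> closed_segment (u i x) (u i y)"
      then have z: "u i x / 2 \<le> z" "z \<le> 2 * u i x"
        using gauge_comparable[OF *(1-3,5)] *(4)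
        by (auto simp: closed_segment_eq_real_ivl split: if_splits)
      then have pos: "0 < z" using *(4) by linarith
      show "((\<lambda>z. z powr q) has_real_derivative q * z powr (q - 1))
          (at z within closed_segment (u i x) (u i y))"
        using pos by (intro has_real_derivative_powr[THEN DERIV_subset]) auto
      have "\<bar>q * z powr (q - 1)\<bar> = \<bar>q\<bar> * z powr (q - 1)"
        by (simp add: abs_mult)
      also have "\<dots> \<le> \<bar>q\<bar> * (2 powr \<bar>q - 1\<bar> * u i x powr (q - 1))"
        by (intro mult_left_mono powr_comparable z *) auto
      finally show "norm (q * z powr (q - 1)) \<le> L * u i x powr (q - 1)"
        by (simp add: L_def mult_ac)
    qed auto
    also have "\<dots> \<le> (L * u i x powr (q - 1)) * \<bar>x - y\<bar>"
      using gauge_Lipschitz[OF *(1-3)] L by (intro mult_left_mono) auto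
    also have "\<dots> \<le> L * u i x powr (q - s) * \<bar>x - y\<bar> powr s"
      by (rule Lipschitz_imp_holder_step[OF *(4,5) L])
    finally show ?thesis by simp
  qed
  with L show ?thesis by (rule locally_holderI)
qed

text \<open>
  Regularity of a single power of the gauge is inherited by all powers, negative ones
  included. With \<open>f = u\<^sup>b\<close> the derivative of \<open>u\<^sup>q = f\<^bsup>q/b\<^esup>\<close> is \<open>(q/b) u\<^bsup>q-b\<^esup> f'\<close>. It involves a
  different power of \<open>u\<close>, but to one order less, which is why the induction is over all \<open>q\<close> at once.
\<close>

lemma weighted_gauge_powr:
  assumes "0 < b" and f: "\<And>i x. i \<in> I \<Longrightarrow> x \<in> {0..1} \<Longrightarrow> f i x = u i x powr b"
  shows "weighted r b f \<Longrightarrow> weighted r q (\<lambda>i x. u i x powr q)"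
proof (induction r arbitrary: q)
  case 0
  show ?case by (simp add: dominated_gauge_powr locally_holder_gauge_powr)
next
  case (Suc r)
  then obtain f' where der: "has_family_derivative f f'" and f': "weighted r (b - 1) f'"
    by auto
  have "weighted r (q - b) (\<lambda>i x. u i x powr (q - b))"
    by (rule Suc.IH[OF weighted_Suc_imp[OF Suc.prems]])
  then have "weighted r (0 + ((q - b) + (b - 1))) (\<lambda>i x. (q / b) * (u i x powr (q - b) * f' i x))"
    using f' by (intro weighted_mult weighted_const)
  moreover have "has_family_derivative (\<lambda>i x. u i x powr q)
      (\<lambda>i x. (q / b) * (u i x powr (q - b) * f' i x))"
    unfolding has_family_derivative_def
  proof (intro ballI impI)
    fix i x assume *: "i \<in> I" "x \<in> {0..1::real}" "0 < u i x"
    have b: "b * (q / b) = q" "b * (q / b - 1) = q - b"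
      using assms(1) by (simp_all add: right_diff_distrib)
    have "((\<lambda>x. f i x powr (q / b)) has_real_derivative
        q / b * f i x powr (q / b - 1) * f' i x) (at x within {0..1})"
      using has_family_derivativeD[OF der *] *(3) f[OF *(1,2)]
      by (intro has_real_derivative_powr_within) auto
    then have "((\<lambda>x. u i x powr q) has_real_derivative
        q / b * f i x powr (q / b - 1) * f' i x) (at x within {0..1})"
      by (rule has_field_derivative_transform_within[OF _ zero_less_one *(2)])
        (use assms(1) in \<open>simp add: f[OF *(1)] powr_powr b\<close>)
    then show "((\<lambda>x. u i x powr q) has_real_derivative
        q / b * (u i x powr (q - b) * f' i x)) (at x within {0..1})"
      by (simp only: f[OF *(1,2)] powr_powr b mult.assoc)
  qed
  ultimately show ?case
    by (auto simp: dominated_gauge_powr)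
qed

lemma weighted_obtain_derivatives:
  "weighted r p g \<Longrightarrow> \<exists>G. G 0 = g \<and> (\<forall>j<r. has_family_derivative (G j) (G (Suc j))) \<and>
     (\<forall>j\<le>r. dominated (p - real j) (G j)) \<and> locally_holder (p - real r) (G r)"
proof (induction r arbitrary: p g)
  case 0
  then show ?case by (intro exI[of _ "\<lambda>_. g"]) auto
next
  case (Suc r)
  then obtain g' where der: "has_family_derivative g g'" and g': "weighted r (p - 1) g'"
    by auto
  from Suc.IH[OF g'] obtain G where G: "G 0 = g'"
    "\<And>j. j < r \<Longrightarrow> has_family_derivative (G j) (G (Suc j))"
    "\<And>j. j \<le> r \<Longrightarrow> dominated (p - 1 - real j) (G j)" "locally_holder (p - 1 - real r) (G r)"
    by auto
  show ?case
    using G der Suc.prems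
    by (intro exI[of _ "case_nat g G"]) (auto split: nat.splits simp: diff_diff_eq)
qed

text \<open>
  The exponent \<open>q = m + s\<close> is positive after up to \<open>m\<close> differentiations. The derivatives therefore
  tend to \<open>0\<close> at the zeros of the gauge, at a rate that makes the extension by \<open>0\<close> differentiable
  there up to order \<open>m\<close>, and Hoelder continuous with exponent \<open>s\<close> at that order.
\<close>

lemma weighted_extend_by_zero:
  assumes w: "weighted m q g" and q: "q = real m + s"
    and g: "\<And>i x. i \<in> I \<Longrightarrow> x \<in> {0..1} \<Longrightarrow> u i x = 0 \<Longrightarrow> g i x = 0"
  shows "\<exists>M\<ge>1. \<forall>i\<in>I. \<exists>G. is_jet m G \<and> (\<forall>x\<in>{0..1}. G 0 x = g i x) \<and>
    (\<forall>j\<le>m. \<forall>x\<in>{0..1}. \<bar>G j x\<bar> \<le> M * u i x powr (q - real j)) \<and>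
    (\<forall>x\<in>{0..1}. \<forall>y\<in>{0..1}. \<bar>G m x - G m y\<bar> \<le> M * \<bar>x - y\<bar> powr s)"
proof -
  from weighted_obtain_derivatives[OF w] obtain H where H0: "H 0 = g"
    and H_der: "\<And>j. j < m \<Longrightarrow> has_family_derivative (H j) (H (Suc j))"
    and H_dom: "\<And>j. j \<le> m \<Longrightarrow> dominated (q - real j) (H j)"
    and H_hol: "locally_holder (q - real m) (H m)"
    by blast
  from H_dom have "\<forall>j\<in>{..m}. \<exists>M. dominated_by M (q - real j) (H j)"
    by (simp add: dominated_def)
  from bchoice[OF this] obtain A where A: "\<And>j. j \<le> m \<Longrightarrow> dominated_by (A j) (q - real j) (H j)"
    by auto
  from H_hol obtain L where L_by: "holder_by L (q - real m) (H m)"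
    unfolding locally_holder_def by blast
  note L = holder_byD[OF L_by]
  define K where "K = 1 + (\<Sum>j\<le>m. A j) + L"
  have A_nonneg: "0 \<le> A j" if "j \<le> m" for j
    using dominated_byD(1)[OF A[OF that]] .
  then have "0 \<le> (\<Sum>j\<le>m. A j)" by (intro sum_nonneg) auto
  with L(1) have K1: "1 \<le> K" and LK: "L \<le> K" by (simp_all add: K_def)
  have AK: "A j \<le> K" if "j \<le> m" for j
  proof -
    have "A j \<le> (\<Sum>j\<le>m. A j)"
      using that A_nonneg by (intro member_le_sum) auto
    with L(1) show ?thesis by (simp add: K_def)
  qed
  have "\<exists>G. is_jet m G \<and> (\<forall>x\<in>{0..1}. G 0 x = g i x) \<and>
    (\<forall>j\<le>m. \<forall>x\<in>{0..1}. \<bar>G j x\<bar> \<le> (4 * K) * u i x powr (q - real j)) \<and>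
    (\<forall>x\<in>{0..1}. \<forall>y\<in>{0..1}. \<bar>G m x - G m y\<bar> \<le> (4 * K) * \<bar>x - y\<bar> powr s)"
    if i: "i \<in> I" for i
  proof -
    define G where "G = (\<lambda>j x. if 0 < u i x then H j i x else 0)"
    have G_zero: "G j x = 0" if "u i x = 0" for j x
      using that by (simp add: G_def)
    (* This includes the zeros of the gauge, because 0 powr p = 0. *)
    have G_le: "\<bar>G j x\<bar> \<le> K * u i x powr (q - real j)" if "j \<le> m" "x \<in> {0..1}" for j x
    proof (cases "0 < u i x")
      case True
      then have "\<bar>G j x\<bar> \<le> A j * u i x powr (q - real j)"
        using dominated_byD(2)[OF A[OF that(1)] i that(2)] by (simp add: G_def)
      also have "\<dots> \<le> K * u i x powr (q - real j)"
        using AK[OF that(1)] by (intro mult_right_mono) auto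
      finally show ?thesis .
    qed (use K1 in \<open>simp add: G_def\<close>)
    have G0: "G 0 x = g i x" if "x \<in> {0..1}" for x
    proof (cases "0 < u i x")
      case False
      then have "u i x = 0" using gauge_nonneg[of i x] by linarith
      with g[OF i that] show ?thesis by (simp add: G_def)
    qed (simp add: G_def H0)
    have jet: "is_jet m G"
      unfolding is_jet_def
    proof (intro allI impI ballI)
      fix j x assume j: "j < m" and x: "x \<in> {0..1::real}"
      show "(G j has_real_derivative G (Suc j) x) (at x within {0..1})"
      proof (cases "0 < u i x")
        case True
        have "(H j i has_real_derivative H (Suc j) i x) (at x within {0..1})"
          using has_family_derivativeD[OF H_der[OF j] i x True] .
        then have "(G j has_real_derivative H (Suc j) i x) (at x within {0..1})"
        proof (rule has_field_derivative_transform_within[OF _ True x])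
          fix y :: real assume y: "y \<in> {0..1}" "dist y x < u i x"
          then have "0 < u i y"
            using gauge_Lipschitz[OF i x y(1)] by (auto simp: dist_real_def)
          then show "H j i y = G j y" by (simp add: G_def)
        qed
        with True show ?thesis by (simp add: G_def)
      next
        case False
        then have ux: "u i x = 0" using gauge_nonneg[of i x] by linarith
        (* As j + 1 \<le> m and s > 0, the difference quotient is bounded by a positive power. *)
        have e: "0 < q - real j - 1" using j s_pos by (simp add: q)
        have "((\<lambda>y. (G j y - G j x) / (y - x)) \<longlongrightarrow> 0) (at x within {0..1})"
        proof (rule Lim_null_comparison)
          have "norm ((G j y - G j x) / (y - x)) \<le> K * \<bar>y - x\<bar> powr (q - real j - 1)"
            if y: "y \<in> {0..1}" "y \<noteq> x" for y
          proof -
            have "u i y \<le> \<bar>y - x\<bar>"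
              using gauge_Lipschitz[OF i y(1) x] ux by simp
            then have "u i y powr (q - real j) \<le> \<bar>y - x\<bar> powr (q - real j)"
              using e gauge_nonneg by (intro powr_mono2) auto
            then have "\<bar>G j y\<bar> \<le> K * \<bar>y - x\<bar> powr (q - real j)"
              using G_le[of j y] j y(1) K1 by (smt (verit) mult_left_mono less_imp_le)
            then have "\<bar>G j y\<bar> / \<bar>y - x\<bar> \<le> K * \<bar>y - x\<bar> powr (q - real j) / \<bar>y - x\<bar>"
              by (intro divide_right_mono) auto
            also have "\<dots> = K * \<bar>y - x\<bar> powr (q - real j - 1)"
              using y(2) by (simp add: powr_diff)
            finally show ?thesis by (simp add: G_zero[OF ux])
          qed
          then show "\<forall>\<^sub>F y in at x within {0..1}.
              norm ((G j y - G j x) / (y - x)) \<le> K * \<bar>y - x\<bar> powr (q - real j - 1)"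
            unfolding eventually_at by (intro exI[of _ 1]) auto
          have "((\<lambda>y. \<bar>y - x\<bar>) \<longlongrightarrow> 0) (at x within {0..1})"
            by (auto intro!: tendsto_eq_intros)
          then have "((\<lambda>y. \<bar>y - x\<bar> powr (q - real j - 1)) \<longlongrightarrow> 0) (at x within {0..1})"
            using e by (intro tendsto_zero_powrI[OF _ tendsto_const]) auto
          then show "((\<lambda>y. K * \<bar>y - x\<bar> powr (q - real j - 1)) \<longlongrightarrow> 0) (at x within {0..1})"
            by (rule tendsto_mult_right_zero)
        qed
        then show ?thesis
          by (simp add: has_field_derivative_iff G_zero[OF ux])
      qed
    qed
    (* By symmetry the base point x may be taken to have the larger gauge. *)
    have hol: "\<bar>G m x - G m y\<bar> \<le> (4 * K) * \<bar>x - y\<bar> powr s"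
      if xy: "x \<in> {0..1}" "y \<in> {0..1}" and le: "u i y \<le> u i x" for x y
    proof -
      consider "u i x = 0" | "0 < u i x" "\<bar>x - y\<bar> \<le> u i x / 2" | "u i x < 2 * \<bar>x - y\<bar>"
        using order_le_less[of 0 "u i x"] gauge_nonneg[of i x] by fastforce
      then show ?thesis
      proof cases
        case 1
        then have "u i y = 0" using le gauge_nonneg[of i y] by linarith
        with 1 K1 show ?thesis by (simp add: G_zero)
      next
        case 2
        then have pos: "0 < u i y"
          using gauge_comparable(1)[OF i xy] by linarith
        have "\<bar>G m x - G m y\<bar> \<le> L * u i x powr (q - real m - s) * \<bar>x - y\<bar> powr s"
          using L(2)[OF i xy 2] 2(1) pos by (simp add: G_def)
        also have "\<dots> = L * \<bar>x - y\<bar> powr s"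
          using 2(1) by (simp add: q)
        also have "\<dots> \<le> (4 * K) * \<bar>x - y\<bar> powr s"
          using LK K1 by (intro mult_right_mono) auto
        finally show ?thesis .
      next
        case 3
        have *: "\<bar>G m z\<bar> \<le> K * (2 * \<bar>x - y\<bar> powr s)" if z: "z \<in> {0..1}" "u i z \<le> u i x" for z
        proof -
          have "u i z powr s \<le> (2 * \<bar>x - y\<bar>) powr s"
            using 3 z gauge_nonneg[of i z] s_pos by (intro powr_mono2) auto
          also have "\<dots> = 2 powr s * \<bar>x - y\<bar> powr s"
            by (rule powr_mult)
          also have "\<dots> \<le> 2 * \<bar>x - y\<bar> powr s"
            using powr_mono[of s 1 2] s_le_1 by (intro mult_right_mono) auto
          finally have "K * u i z powr s \<le> K * (2 * \<bar>x - y\<bar> powr s)"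
            using K1 by (intro mult_left_mono) auto
          with G_le[of m z] z(1) show ?thesis by (simp add: q)
        qed
        show ?thesis
          using *[OF xy(1)] *[OF xy(2) le] by linarith
      qed
    qed
    have "\<bar>G m x - G m y\<bar> \<le> (4 * K) * \<bar>x - y\<bar> powr s"
      if "x \<in> {0..1}" "y \<in> {0..1}" for x y
    proof (cases "u i y \<le> u i x")
      case True
      with hol that show ?thesis by blast
    next
      case False
      with hol[of y x] that show ?thesis by (simp add: abs_minus_commute)
    qed
    moreover have "\<bar>G j x\<bar> \<le> (4 * K) * u i x powr (q - real j)" if "j \<le> m" "x \<in> {0..1}" for j x
    proof -
      have "K * u i x powr (q - real j) \<le> (4 * K) * u i x powr (q - real j)"
        using K1 by (intro mult_right_mono) auto
      with G_le[OF that] show ?thesis by linarith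
    qed
    ultimately show ?thesis
      using jet G0 by (intro exI[of _ G]) blast
  qed
  moreover have "1 \<le> 4 * K" using K1 by simp
  ultimately show ?thesis by blast
qed

end

section \<open>Normalised flat functions and their powers\<close>

lemma strict_floor_bounds:
  assumes "0 < b"
  shows "real (strict_floor b) < b" "b \<le> real (strict_floor b) + 1"
proof -
  show "real (strict_floor b) < b"
    using le_strict_floor_iff[OF assms, of "strict_floor b"] by simp
  show "b \<le> real (strict_floor b) + 1"
    using le_strict_floor_iff[OF assms, of "Suc (strict_floor b)"] by simp
qed

lemma strict_floor_eq_0: "b \<le> 1 \<Longrightarrow> strict_floor b = 0"
  unfolding strict_floor_def by (simp add: ceiling_le_iff)

text \<open>
  The bounds that hold for a function of flat norm below \<open>1\<close> and its derivatives \<open>F j\<close>. The exponents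
  \<open>(\<beta> - j) / \<beta>\<close> come from taking \<open>\<beta>\<close>-th roots in the flatness condition with \<open>\<kappa> = 1\<close>.
\<close>

definition unit_flat_jet :: "real \<Rightarrow> (nat \<Rightarrow> real \<Rightarrow> real) \<Rightarrow> bool" where
  "unit_flat_jet \<beta> F \<longleftrightarrow>
     is_jet (strict_floor \<beta>) F \<and>
     (\<forall>x\<in>{0..1}. 0 \<le> F 0 x \<and> F 0 x \<le> 1) \<and>
     (\<forall>j\<in>{1..strict_floor \<beta>}. \<forall>x\<in>{0..1}. \<bar>F j x\<bar> \<le> F 0 x powr ((\<beta> - real j) / \<beta>)) \<and>
     (\<forall>x\<in>{0..1}. \<forall>y\<in>{0..1}.
        \<bar>F (strict_floor \<beta>) x - F (strict_floor \<beta>) y\<bar>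
          \<le> \<bar>x - y\<bar> powr (\<beta> - real (strict_floor \<beta>)))"

text \<open>
  Formally \<open>(f\<^bsup>1/\<beta>\<^esup>)' = (1/\<beta>) f\<^bsup>1/\<beta>-1\<^esup> f'\<close> is bounded by \<open>1/\<beta>\<close>. At zeros of \<open>f\<close> the root need not be
  differentiable, so the estimate is proved for \<open>f + \<epsilon>\<close> and \<open>\<epsilon>\<close> tends to \<open>0\<close>.
\<close>

lemma root_Lipschitz:
  fixes f f' :: "real \<Rightarrow> real"
  assumes "1 < \<beta>" "convex S" and f_nonneg: "\<And>x. x \<in> S \<Longrightarrow> 0 \<le> f x"
    and der: "\<And>x. x \<in> S \<Longrightarrow> (f has_real_derivative f' x) (at x within S)"
    and f'_le: "\<And>x. x \<in> S \<Longrightarrow> \<bar>f' x\<bar> \<le> f x powr ((\<beta> - 1) / \<beta>)"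
    and xy: "x \<in> S" "y \<in> S"
  shows "\<bar>f x powr (1 / \<beta>) - f y powr (1 / \<beta>)\<bar> \<le> \<bar>x - y\<bar>"
proof -
  have shifted: "\<bar>(f x + \<epsilon>) powr (1 / \<beta>) - (f y + \<epsilon>) powr (1 / \<beta>)\<bar> \<le> \<bar>x - y\<bar>" if "0 < \<epsilon>" for \<epsilon>
  proof -
    have "norm ((f x + \<epsilon>) powr (1 / \<beta>) - (f y + \<epsilon>) powr (1 / \<beta>)) \<le> 1 * norm (x - y)"
    proof (rule field_differentiable_bound[OF assms(2)])
      fix z assume z: "z \<in> S"
      have pos: "0 < f z + \<epsilon>" using f_nonneg[OF z] that by linarith
      have "((\<lambda>z. f z + \<epsilon>) has_real_derivative f' z) (at z within S)"
        using der[OF z] by (auto intro!: derivative_eq_intros)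
      from has_real_derivative_powr_within[OF this pos]
      show "((\<lambda>z. (f z + \<epsilon>) powr (1 / \<beta>)) has_real_derivative
          1 / \<beta> * (f z + \<epsilon>) powr (1 / \<beta> - 1) * f' z) (at z within S)" .
      have "\<bar>f' z\<bar> \<le> (f z + \<epsilon>) powr ((\<beta> - 1) / \<beta>)"
        using f'_le[OF z] powr_mono2[of "(\<beta> - 1) / \<beta>" "f z" "f z + \<epsilon>"] f_nonneg[OF z] that assms(1)
        by simp
      then have "(f z + \<epsilon>) powr (1 / \<beta> - 1) * \<bar>f' z\<bar>
          \<le> (f z + \<epsilon>) powr (1 / \<beta> - 1) * (f z + \<epsilon>) powr ((\<beta> - 1) / \<beta>)"
        by (intro mult_left_mono) auto
      also have "\<dots> = (f z + \<epsilon>) powr (1 / \<beta> - 1 + (\<beta> - 1) / \<beta>)"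
        by (rule powr_add[symmetric])
      also have "1 / \<beta> - 1 + (\<beta> - 1) / \<beta> = 0"
        using assms(1) by (simp add: diff_divide_distrib)
      also have "(f z + \<epsilon>) powr 0 = 1"
        using pos by simp
      finally have *: "(f z + \<epsilon>) powr (1 / \<beta> - 1) * \<bar>f' z\<bar> \<le> 1" .
      have "norm (1 / \<beta> * (f z + \<epsilon>) powr (1 / \<beta> - 1) * f' z)
          = 1 / \<beta> * ((f z + \<epsilon>) powr (1 / \<beta> - 1) * \<bar>f' z\<bar>)"
        using assms(1) by (simp add: abs_mult)
      also have "\<dots> \<le> 1 / \<beta> * 1"
        using * assms(1) by (intro mult_left_mono) auto
      also have "\<dots> \<le> 1" using assms(1) by simp
      finally show "norm (1 / \<beta> * (f z + \<epsilon>) powr (1 / \<beta> - 1) * f' z) \<le> 1" .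
    qed (use xy in auto)
    then show ?thesis by simp
  qed
  have lim: "((\<lambda>\<epsilon>. (f z + \<epsilon>) powr (1 / \<beta>)) \<longlongrightarrow> f z powr (1 / \<beta>)) (at_right 0)" if "z \<in> S" for z
  proof (rule tendsto_powr')
    show "((\<lambda>\<epsilon>. f z + \<epsilon>) \<longlongrightarrow> f z) (at_right 0)"
      by (auto intro!: tendsto_eq_intros)
    have "\<forall>\<^sub>F \<epsilon> in at_right (0::real). 0 < \<epsilon>"
      by (rule eventually_at_right_less)
    then have "\<forall>\<^sub>F \<epsilon> in at_right 0. 0 \<le> f z + \<epsilon>"
      by eventually_elim (use f_nonneg[OF that] in auto)
    then show "f z \<noteq> 0 \<or> 0 < 1 / \<beta> \<and> (\<forall>\<^sub>F \<epsilon> in at_right 0. 0 \<le> f z + \<epsilon>)"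
      using assms(1) by simp
  qed simp
  have "((\<lambda>\<epsilon>. \<bar>(f x + \<epsilon>) powr (1 / \<beta>) - (f y + \<epsilon>) powr (1 / \<beta>)\<bar>) \<longlongrightarrow>
      \<bar>f x powr (1 / \<beta>) - f y powr (1 / \<beta>)\<bar>) (at_right 0)"
    by (intro tendsto_intros lim xy)
  moreover have "\<forall>\<^sub>F \<epsilon> in at_right (0::real).
      \<bar>(f x + \<epsilon>) powr (1 / \<beta>) - (f y + \<epsilon>) powr (1 / \<beta>)\<bar> \<le> \<bar>x - y\<bar>"
    using eventually_at_right_less[of 0] by eventually_elim (rule shifted)
  ultimately show ?thesis
    by (rule tendsto_upperbound) simp
qed

text \<open>
  The Hoelder exponent throughout is \<open>s = \<alpha>\<beta> - m\<close>, the one required of \<open>f\<^sup>\<alpha>\<close>. The derivative of \<open>f\<close>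
  of order \<open>m\<close> satisfies the local Hoelder condition for this \<open>s\<close>, for one of two reasons. Let \<open>n\<close> be the
  largest integer below \<open>\<beta>\<close>. The derivative of order \<open>m\<close> has another derivative if \<open>m < n\<close>, and if
  \<open>m = n\<close> it is Hoelder with an exponent at least \<open>s\<close>, namely \<open>\<beta> - n\<close>.
\<close>

lemma powr_jet_of_smooth:
  fixes \<alpha> \<beta> :: real
  assumes \<alpha>: "0 < \<alpha>" "\<alpha> \<le> 1" and \<beta>: "1 < \<beta>" and m: "m = strict_floor (\<alpha> * \<beta>)"
  shows "\<exists>M\<ge>1. \<forall>F. unit_flat_jet \<beta> F \<longrightarrow>
    (\<exists>G. is_jet m G \<and> (\<forall>x\<in>{0..1}. G 0 x = F 0 x powr \<alpha>) \<and>
      (\<forall>j\<le>m. \<forall>x\<in>{0..1}. \<bar>G j x\<bar> \<le> M * F 0 x powr ((\<alpha> * \<beta> - real j) / \<beta>)) \<and>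
      (\<forall>x\<in>{0..1}. \<forall>y\<in>{0..1}. \<bar>G m x - G m y\<bar> \<le> M * \<bar>x - y\<bar> powr (\<alpha> * \<beta> - real m)))"
proof -
  define n where "n = strict_floor \<beta>"
  define s where "s = \<alpha> * \<beta> - real m"
  have \<alpha>\<beta>: "0 < \<alpha> * \<beta>" "\<alpha> * \<beta> \<le> \<beta>"
    using \<alpha> \<beta> by auto
  have s: "0 < s" "s \<le> 1"
    using strict_floor_bounds[OF \<alpha>\<beta>(1)] by (simp_all add: s_def m)
  have mn: "m \<le> n"
    unfolding n_def using strict_floor_bounds(1)[OF \<alpha>\<beta>(1)] \<alpha>\<beta>(2) \<beta> m
    by (subst le_strict_floor_iff) linarith+
  have n1: "1 \<le> n" using \<beta> by (simp add: n_def le_strict_floor_iff)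
  let ?I = "Collect (unit_flat_jet \<beta>)"
  let ?u = "\<lambda>F x. F (0::nat) (x::real) powr (1 / \<beta>) :: real"
  have jetD: "(F j has_real_derivative F (Suc j) x) (at x within {0..1})"
    if "F \<in> ?I" "j < n" "x \<in> {0..1}" for F j x
    using that by (simp add: unit_flat_jet_def is_jet_def n_def)
  have F0: "0 \<le> F 0 x" if "F \<in> ?I" "x \<in> {0..1}" for F x
    using that by (simp add: unit_flat_jet_def)
  have F_le: "\<bar>F j x\<bar> \<le> F 0 x powr ((\<beta> - real j) / \<beta>)"
    if "F \<in> ?I" "1 \<le> j" "j \<le> n" "x \<in> {0..1}" for F j x
    using that by (simp add: unit_flat_jet_def n_def)
  have F_hol: "\<bar>F n x - F n y\<bar> \<le> \<bar>x - y\<bar> powr (\<beta> - real n)"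
    if "F \<in> ?I" "x \<in> {0..1}" "y \<in> {0..1}" for F x y
    using that by (simp add: unit_flat_jet_def n_def)
  have F0_eq: "F 0 x = ?u F x powr \<beta>" if "F \<in> ?I" "x \<in> {0..1}" for F x
    using F0[OF that] \<beta> by (simp add: powr_powr)
  interpret gauge_family ?I ?u s
  proof
    show "\<bar>?u F x - ?u F y\<bar> \<le> \<bar>x - y\<bar>" if F: "F \<in> ?I" and xy: "x \<in> {0..1}" "y \<in> {0..1}" for F x y
    proof (rule root_Lipschitz[OF \<beta> _ _ _ _ xy])
      show "(F 0 has_real_derivative F 1 z) (at z within {0..1})" if "z \<in> {0..1}" for z
        using jetD[OF F _ that, of 0] n1 by simp
      show "\<bar>F 1 z\<bar> \<le> F 0 z powr ((\<beta> - 1) / \<beta>)" if "z \<in> {0..1}" for z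
        using F_le[OF F _ n1 that] by simp
    qed (use F0[OF F] in auto)
  qed (use s in auto)
  have dom: "dominated (\<beta> - real j) (\<lambda>F. F j)" if "j \<le> n" for j
  proof (rule dominatedI[of 1])
    fix F x assume *: "F \<in> ?I" "x \<in> {0..1::real}"
    show "\<bar>F j x\<bar> \<le> 1 * ?u F x powr (\<beta> - real j)"
    proof (cases "j = 0")
      case True
      with F0_eq[OF *] F0[OF *] show ?thesis by simp
    next
      case False
      then show ?thesis
        using F_le[OF *(1) _ that *(2)] by (simp add: powr_powr)
    qed
  qed simp
  have hol: "locally_holder (\<beta> - real m) (\<lambda>F. F m)"
  proof (cases "m = n")
    case True
    show ?thesis
    proof (rule locally_holderI[of 1])
      fix F x y
      assume *: "F \<in> ?I" "x \<in> {0..1::real}" "y \<in> {0..1::real}" and close: "\<bar>x - y\<bar> \<le> ?u F x / 2"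
      have "0 \<le> ?u F x" by simp
      with close have "\<bar>x - y\<bar> \<le> ?u F x" by linarith
      moreover have "s \<le> \<beta> - real n" using \<alpha>\<beta>(2) True by (simp add: s_def)
      ultimately have "\<bar>x - y\<bar> powr (\<beta> - real n) \<le> \<bar>x - y\<bar> powr s * ?u F x powr (\<beta> - real n - s)"
        by (intro powr_interpolate) auto
      with F_hol[OF *]
      show "\<bar>F m x - F m y\<bar> \<le> 1 * ?u F x powr (\<beta> - real m - s) * \<bar>x - y\<bar> powr s"
        unfolding True by (simp add: mult.commute)
    qed simp
  next
    case False
    with mn have "m < n" by simp
    then have "has_family_derivative (\<lambda>F. F m) (\<lambda>F. F (Suc m))"
      using jetD unfolding has_family_derivative_def by blast
    moreover have "dominated (\<beta> - real m - 1) (\<lambda>F. F (Suc m))"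
      using dom[of "Suc m"] \<open>m < n\<close> by (simp add: diff_diff_eq add.commute)
    ultimately show ?thesis by (rule locally_holder_of_derivative)
  qed
  (* The highest order m is the base case; each step goes down by one derivative. *)
  have "weighted k (\<beta> - real (m - k)) (\<lambda>F. F (m - k))" if "k \<le> m" for k
    using that
  proof (induction k)
    case 0
    with dom[OF mn] hol show ?case by simp
  next
    case (Suc k)
    define j where "j = m - Suc k"
    have j: "m - k = Suc j" "j < n" using Suc.prems mn by (auto simp: j_def)
    have "has_family_derivative (\<lambda>F. F j) (\<lambda>F. F (Suc j))"
      using jetD j(2) unfolding has_family_derivative_def by blast
    moreover have "weighted k (\<beta> - real j - 1) (\<lambda>F. F (Suc j))"
      using Suc.IH Suc.prems by (simp add: j(1) diff_diff_eq add.commute)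
    moreover have "dominated (\<beta> - real j) (\<lambda>F. F j)"
      using dom[of j] j(2) by simp
    ultimately show ?case by (auto simp flip: j_def)
  qed
  from this[of m] have "weighted m \<beta> (\<lambda>F. F 0)" by simp
  then have w: "weighted m (\<alpha> * \<beta>) (\<lambda>F x. ?u F x powr (\<alpha> * \<beta>))"
    by (rule weighted_gauge_powr[of \<beta> "\<lambda>F. F 0", rotated 2]) (use \<beta> F0_eq in simp_all)
  have "\<exists>M\<ge>1. \<forall>F\<in>?I. \<exists>G. is_jet m G \<and> (\<forall>x\<in>{0..1}. G 0 x = ?u F x powr (\<alpha> * \<beta>)) \<and>
    (\<forall>j\<le>m. \<forall>x\<in>{0..1}. \<bar>G j x\<bar> \<le> M * ?u F x powr (\<alpha> * \<beta> - real j)) \<and>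
    (\<forall>x\<in>{0..1}. \<forall>y\<in>{0..1}. \<bar>G m x - G m y\<bar> \<le> M * \<bar>x - y\<bar> powr s)"
    by (rule weighted_extend_by_zero[OF w]) (simp_all add: s_def)
  moreover have "1 / \<beta> * (\<alpha> * \<beta>) = \<alpha>" using \<beta> by simp
  ultimately show ?thesis
    unfolding s_def[symmetric] powr_powr by (simp only: mem_Collect_eq Ball_def) (simp del: powr_powr)
qed

text \<open>
  For \<open>\<beta> \<le> 1\<close> no derivatives occur, and the root \<open>f\<^bsup>1/\<beta>\<^esup>\<close> need not be Lipschitz; instead
  \<open>x \<mapsto> x\<^sup>\<alpha>\<close> is Hoelder continuous with exponent \<open>\<alpha>\<close>.
\<close>

lemma powr_jet:
  fixes \<alpha> \<beta> :: real
  assumes \<alpha>: "0 < \<alpha>" "\<alpha> \<le> 1" and \<beta>: "0 < \<beta>" and m: "m = strict_floor (\<alpha> * \<beta>)"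
  shows "\<exists>M\<ge>1. \<forall>F. unit_flat_jet \<beta> F \<longrightarrow>
    (\<exists>G. is_jet m G \<and> (\<forall>x\<in>{0..1}. G 0 x = F 0 x powr \<alpha>) \<and>
      (\<forall>j\<le>m. \<forall>x\<in>{0..1}. \<bar>G j x\<bar> \<le> M * F 0 x powr ((\<alpha> * \<beta> - real j) / \<beta>)) \<and>
      (\<forall>x\<in>{0..1}. \<forall>y\<in>{0..1}. \<bar>G m x - G m y\<bar> \<le> M * \<bar>x - y\<bar> powr (\<alpha> * \<beta> - real m)))"
proof (cases "1 < \<beta>")
  case True
  from powr_jet_of_smooth[OF \<alpha> this m] show ?thesis .
next
  case False
  then have n: "strict_floor \<beta> = 0" by (simp add: strict_floor_eq_0)
  have "\<alpha> * \<beta> \<le> 1" using \<alpha> \<beta> False by (simp add: mult_le_one)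
  then have m0: "m = 0" by (simp add: m strict_floor_eq_0)
  show ?thesis
  proof (intro exI[of _ 1] conjI allI impI)
    fix F assume F: "unit_flat_jet \<beta> F"
    have "\<bar>F 0 x powr \<alpha> - F 0 y powr \<alpha>\<bar> \<le> \<bar>x - y\<bar> powr (\<alpha> * \<beta>)"
      if "x \<in> {0..1}" "y \<in> {0..1}" for x y
    proof -
      have "\<bar>F 0 x powr \<alpha> - F 0 y powr \<alpha>\<bar> \<le> \<bar>F 0 x - F 0 y\<bar> powr \<alpha>"
        using F that \<alpha> by (intro abs_powr_diff_le) (auto simp: unit_flat_jet_def)
      also have "\<dots> \<le> (\<bar>x - y\<bar> powr \<beta>) powr \<alpha>"
        using F that \<alpha> by (intro powr_mono2) (auto simp: unit_flat_jet_def n)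
      finally show ?thesis by (simp add: powr_powr mult.commute)
    qed
    then show "\<exists>G. is_jet m G \<and> (\<forall>x\<in>{0..1}. G 0 x = F 0 x powr \<alpha>) \<and>
      (\<forall>j\<le>m. \<forall>x\<in>{0..1}. \<bar>G j x\<bar> \<le> 1 * F 0 x powr ((\<alpha> * \<beta> - real j) / \<beta>)) \<and>
      (\<forall>x\<in>{0..1}. \<forall>y\<in>{0..1}. \<bar>G m x - G m y\<bar> \<le> 1 * \<bar>x - y\<bar> powr (\<alpha> * \<beta> - real m))"
      using \<beta> by (intro exI[of _ "\<lambda>_ x. F 0 x powr \<alpha>"]) (simp add: m0 is_jet_def)
  qed simp
qed

section \<open>Norms in terms of derivative sequences\<close>

lemma deriv_within_jet:
  assumes jet: "is_jet m G" and h: "\<And>x. x \<in> {0..1} \<Longrightarrow> h x = G 0 x"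
  shows "j \<le> m \<Longrightarrow> x \<in> {0..1} \<Longrightarrow> deriv_within {0..1} j h x = G j x"
proof (induction j arbitrary: x)
  case 0
  then show ?case by (simp add: deriv_within_def h)
next
  case (Suc j)
  have "(G j has_real_derivative G (Suc j) x) (at x within {0..1})"
    using jet Suc.prems by (simp add: is_jet_def)
  then have "(deriv_within {0..1} j h has_real_derivative G (Suc j) x) (at x within {0..1})"
    by (rule has_field_derivative_transform_within[OF _ zero_less_one Suc.prems(2)])
      (use Suc in simp)
  then have "vector_derivative (deriv_within {0..1} j h) (at x within {0..1}) = G (Suc j) x"
    using Suc.prems
    by (intro vector_derivative_within_closed_interval)
      (auto simp: has_real_derivative_iff_has_vector_derivative)
  then show ?case by (simp add: deriv_within_def)
qed

lemma times_differentiable_on_jet: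
  assumes jet: "is_jet m G" and h: "\<And>x. x \<in> {0..1} \<Longrightarrow> h x = G 0 x"
  shows "times_differentiable_on m h {0..1}"
  unfolding times_differentiable_on_def
proof (intro allI impI ballI)
  fix j x assume j: "j < m" and x: "x \<in> {0..1::real}"
  have "(G j has_real_derivative G (Suc j) x) (at x within {0..1})"
    using jet j x by (simp add: is_jet_def)
  then have "(deriv_within {0..1} j h has_real_derivative G (Suc j) x) (at x within {0..1})"
    by (rule has_field_derivative_transform_within[OF _ zero_less_one x])
      (use deriv_within_jet[OF jet h] j in simp)
  then show "deriv_within {0..1} j h differentiable (at x within {0..1})"
    using real_differentiable_def by blast
qed

lemma flat_norm_le_jet:
  assumes b: "0 < b" and m: "m = strict_floor b"
    and jet: "is_jet m G" and h: "\<And>x. x \<in> {0..1} \<Longrightarrow> h x = G 0 x"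
    and nonneg: "0 \<le> A" "0 \<le> B" "0 \<le> H" "0 \<le> \<kappa>"
    and A: "\<And>x. x \<in> {0..1} \<Longrightarrow> \<bar>G 0 x\<bar> \<le> A"
    and B: "\<And>x. x \<in> {0..1} \<Longrightarrow> \<bar>G m x\<bar> \<le> B"
    and H: "\<And>x y. x \<in> {0..1} \<Longrightarrow> y \<in> {0..1} \<Longrightarrow>
      \<bar>G m x - G m y\<bar> \<le> H * \<bar>x - y\<bar> powr (b - real m)"
    and \<kappa>: "\<And>j x. 1 \<le> j \<Longrightarrow> j \<le> m \<Longrightarrow> x \<in> {0..1} \<Longrightarrow>
      \<bar>G j x\<bar> powr b \<le> \<kappa> ^ j * \<bar>G 0 x\<bar> powr (b - real j)"
  shows "flat_norm b h \<le> ennreal (A + B + H + \<kappa>)"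
proof -
  have d: "deriv_within {0..1} j h x = G j x" if "j \<le> m" "x \<in> {0..1}" for j x
    using deriv_within_jet[OF jet _ that] h by blast
  have "sup_norm {0..1} h \<le> ennreal A"
    unfolding sup_norm_def by (intro SUP_least ennreal_leI) (simp add: h A)
  moreover have "sup_norm {0..1} (deriv_within {0..1} m h) \<le> ennreal B"
    unfolding sup_norm_def by (intro SUP_least ennreal_leI) (simp only: d[OF le_refl] B)
  moreover have "holder_seminorm {0..1} b h \<le> ennreal H"
    unfolding holder_seminorm_def Let_def m[symmetric]
  proof (intro SUP_least)
    fix p :: "real \<times> real" assume p: "p \<in> {(x, y). x \<in> {0..1} \<and> y \<in> {0..1} \<and> x \<noteq> y}"
    obtain x y where [simp]: "p = (x, y)" by (cases p)
    have xy: "x \<in> {0..1}" "y \<in> {0..1}" "x \<noteq> y" using p by auto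
    have "\<bar>G m x - G m y\<bar> / \<bar>x - y\<bar> powr (b - real m) \<le> H"
      using H[OF xy(1,2)] xy(3) by (simp add: pos_divide_le_eq)
    then show "(case p of (x, y) \<Rightarrow> ennreal (\<bar>deriv_within {0..1} m h x - deriv_within {0..1} m h y\<bar>
        / \<bar>x - y\<bar> powr (b - real m))) \<le> ennreal H"
      using d[OF le_refl xy(1)] d[OF le_refl xy(2)] by (simp add: ennreal_leI)
  qed
  moreover have "flat_seminorm b h \<le> ennreal \<kappa>"
    unfolding flat_seminorm_def
  proof (rule Inf_lower, clarify, intro exI[of _ \<kappa>] conjI ballI allI impI refl nonneg)
    fix x j assume x: "x \<in> {0..1::real}" and j: "1 \<le> j \<and> real j < b"
    then have "j \<le> m" using le_strict_floor_iff[OF b] m by simp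
    with \<kappa>[OF _ this x] j x show
      "\<bar>deriv_within {0..1} j h x\<bar> powr b \<le> \<kappa> ^ j * \<bar>h x\<bar> powr (b - real j)"
      by (simp add: d h)
  qed
  ultimately have "flat_norm b h \<le> ennreal A + ennreal B + ennreal H + ennreal \<kappa>"
    unfolding flat_norm_def holder_norm_def m[symmetric] by (intro add_mono)
  also have "\<dots> = ennreal (A + B + H + \<kappa>)"
    using nonneg by (simp add: ennreal_plus)
  finally show ?thesis .
qed

text \<open>
  A strict upper bound \<open>K\<close> for the norm is used because the flat seminorm is an infimum: every number
  above it exceeds some admissible constant.
\<close>

lemma unit_flat_jet_of_flat_space:
  assumes \<beta>: "0 < \<beta>" and f: "f \<in> flat_space \<beta>" and K: "enn2real (flat_norm \<beta> f) < K"
  shows "unit_flat_jet \<beta> (\<lambda>j x. deriv_within {0..1} j f x / K)"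
proof -
  let ?n = "strict_floor \<beta>"
  have fin: "flat_norm \<beta> f < \<infinity>" and f_nonneg: "\<And>x. x \<in> {0..1} \<Longrightarrow> 0 \<le> f x"
    and diff: "times_differentiable_on ?n f {0..1}"
    using f by (auto simp: flat_space_def holder_space_def)
  have K0: "0 < K" using K enn2real_nonneg[of "flat_norm \<beta> f"] by linarith
  have "flat_norm \<beta> f = ennreal (enn2real (flat_norm \<beta> f))"
    using fin by simp
  also have "\<dots> < ennreal K"
    using K by (simp add: ennreal_less_iff)
  finally have norm: "flat_norm \<beta> f < ennreal K" .
  have parts: "sup_norm {0..1} f \<le> flat_norm \<beta> f" "holder_seminorm {0..1} \<beta> f \<le> flat_norm \<beta> f"
    "flat_seminorm \<beta> f \<le> flat_norm \<beta> f"
    unfolding flat_norm_def holder_norm_def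
    by (simp_all add: add.assoc add_increasing add_increasing2)
  have d0: "deriv_within {0..1} 0 f = f" by (simp add: deriv_within_def)
  have f_le: "f x \<le> K" if "x \<in> {0..1}" for x
  proof -
    have "ennreal \<bar>f x\<bar> \<le> sup_norm {0..1} f"
      unfolding sup_norm_def by (rule SUP_upper[OF that])
    also have "\<dots> < ennreal K"
      using parts(1) norm by (rule le_less_trans)
    finally show ?thesis by (simp add: ennreal_less_iff)
  qed
  have jet: "is_jet ?n (\<lambda>j x. deriv_within {0..1} j f x / K)"
    unfolding is_jet_def
  proof (intro allI impI ballI)
    fix j x assume "j < ?n" and x: "x \<in> {0..1::real}"
    then have "deriv_within {0..1} j f differentiable (at x within {0..1})"
      using diff by (auto simp: times_differentiable_on_def)
    then have "(deriv_within {0..1} j f has_real_derivative deriv_within {0..1} (Suc j) f x)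
        (at x within {0..1})"
      by (simp add: has_real_derivative_iff_has_vector_derivative vector_derivative_works
            deriv_within_def)
    then show "((\<lambda>x. deriv_within {0..1} j f x / K) has_real_derivative
        deriv_within {0..1} (Suc j) f x / K) (at x within {0..1})"
      by (rule DERIV_cdivide)
  qed
  have hol: "\<bar>deriv_within {0..1} ?n f x / K - deriv_within {0..1} ?n f y / K\<bar>
      \<le> \<bar>x - y\<bar> powr (\<beta> - real ?n)" if xy: "x \<in> {0..1}" "y \<in> {0..1}" for x y
  proof (cases "x = y")
    case False
    let ?d = "\<bar>deriv_within {0..1} ?n f x - deriv_within {0..1} ?n f y\<bar>"
    have "ennreal (?d / \<bar>x - y\<bar> powr (\<beta> - real ?n)) \<le> holder_seminorm {0..1} \<beta> f"
      unfolding holder_seminorm_def Let_def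
      by (rule SUP_upper2[of "(x, y)"]) (use xy False in auto)
    also have "\<dots> < ennreal K"
      using parts(2) norm by (rule le_less_trans)
    finally have "?d / \<bar>x - y\<bar> powr (\<beta> - real ?n) \<le> K"
      by (simp add: ennreal_less_iff)
    then have "?d \<le> K * \<bar>x - y\<bar> powr (\<beta> - real ?n)"
      using False by (simp add: pos_divide_le_eq)
    then have "?d / K \<le> \<bar>x - y\<bar> powr (\<beta> - real ?n)"
      using K0 by (simp add: pos_divide_le_eq mult.commute)
    then show ?thesis
      using K0 by (simp flip: diff_divide_distrib)
  qed simp
  have flat: "\<bar>deriv_within {0..1} j f x / K\<bar> \<le> (f x / K) powr ((\<beta> - real j) / \<beta>)"
    if j: "1 \<le> j" "j \<le> ?n" and x: "x \<in> {0..1}" for j x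
  proof -
    let ?d = "\<bar>deriv_within {0..1} j f x\<bar>"
    have "flat_seminorm \<beta> f < ennreal K"
      using parts(3) norm by (rule le_less_trans)
    then obtain \<kappa> where \<kappa>: "0 \<le> \<kappa>" "ennreal \<kappa> < ennreal K"
      "\<forall>x\<in>{0..1}. \<forall>j::nat. 1 \<le> j \<and> real j < \<beta> \<longrightarrow>
        \<bar>deriv_within {0..1} j f x\<bar> powr \<beta> \<le> \<kappa> ^ j * \<bar>f x\<bar> powr (\<beta> - real j)"
      unfolding flat_seminorm_def Inf_less_iff by blast
    have "?d powr \<beta> \<le> \<kappa> ^ j * \<bar>f x\<bar> powr (\<beta> - real j)"
      using \<kappa>(3) x j le_strict_floor_iff[OF \<beta>] by simp
    also have "\<dots> \<le> K ^ j * \<bar>f x\<bar> powr (\<beta> - real j)"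
      using \<kappa>(1,2) by (intro mult_right_mono power_mono) (auto simp: ennreal_less_iff)
    (* Splitting K ^ j this way normalises both sides of the inequality. *)
    also have "K ^ j = K powr \<beta> / K powr (\<beta> - real j)"
      using K0 by (simp add: powr_realpow flip: powr_diff)
    finally have "?d powr \<beta> \<le> K powr \<beta> * (\<bar>f x\<bar> powr (\<beta> - real j) / K powr (\<beta> - real j))"
      by simp
    also have "\<bar>f x\<bar> powr (\<beta> - real j) / K powr (\<beta> - real j) = (f x / K) powr (\<beta> - real j)"
      using f_nonneg[OF x] by (simp add: powr_divide)
    finally have "?d powr \<beta> / K powr \<beta> \<le> (f x / K) powr (\<beta> - real j)"
      using K0 by (simp add: pos_divide_le_eq mult.commute)
    then have "(?d / K) powr \<beta> \<le> (f x / K) powr (\<beta> - real j)"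
      by (simp only: powr_divide)
    then have "((?d / K) powr \<beta>) powr (1 / \<beta>) \<le> ((f x / K) powr (\<beta> - real j)) powr (1 / \<beta>)"
      using \<beta> by (intro powr_mono2) auto
    then show ?thesis
      using \<beta> K0 by (simp add: powr_powr)
  qed
  show ?thesis
    unfolding unit_flat_jet_def d0
    using jet hol flat f_nonneg f_le K0 by simp
qed

section \<open>Powers of flat functions\<close>

text \<open>
  The summands of \<open>C\<close> are the constants for the sup norm of \<open>f\<^sup>\<alpha>\<close>, the sup norm and the Hoelder seminorm
  of its highest derivative (\<open>M\<close> each), and the flat seminorm. The last is \<open>M\<^bsup>\<alpha>\<beta>\<^esup>\<close> since a factor
  \<open>M \<ge> 1\<close> in front of each derivative has to be absorbed in \<open>\<kappa>\<^sup>j\<close> for every \<open>j \<ge> 1\<close>.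
\<close>

theorem theorem1:
  fixes \<alpha> \<beta> :: real
  assumes "0 < \<alpha>" and "\<alpha> \<le> 1" and "0 < \<beta>"
  shows "\<exists>C::real. \<forall>f \<in> flat_space \<beta>.
    (\<lambda>x. f x powr \<alpha>) \<in> flat_space (\<alpha> * \<beta>) \<and>
    holder_norm {0..1} (\<alpha> * \<beta>) (\<lambda>x. f x powr \<alpha>) \<le> flat_norm (\<alpha> * \<beta>) (\<lambda>x. f x powr \<alpha>) \<and>
    flat_norm (\<alpha> * \<beta>) (\<lambda>x. f x powr \<alpha>) \<le> ennreal (C * enn2real (flat_norm \<beta> f) powr \<alpha>)"
proof -
  define b where "b = \<alpha> * \<beta>"
  define m where "m = strict_floor b"
  have b: "0 < b" using assms by (simp add: b_def)
  have mb: "real m < b" using strict_floor_bounds(1)[OF b] by (simp add: m_def)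
  from powr_jet[OF assms, of m] obtain M where M1: "1 \<le> M"
    and M: "\<And>F. unit_flat_jet \<beta> F \<Longrightarrow>
      \<exists>G. is_jet m G \<and> (\<forall>x\<in>{0..1}. G 0 x = F 0 x powr \<alpha>) \<and>
        (\<forall>j\<le>m. \<forall>x\<in>{0..1}. \<bar>G j x\<bar> \<le> M * F 0 x powr ((b - real j) / \<beta>)) \<and>
        (\<forall>x\<in>{0..1}. \<forall>y\<in>{0..1}. \<bar>G m x - G m y\<bar> \<le> M * \<bar>x - y\<bar> powr (b - real m))"
    unfolding m_def b_def by blast
  define C where "C = 1 + 2 * M + M powr b"
  have scaled: "times_differentiable_on m (\<lambda>x. f x powr \<alpha>) {0..1} \<and>
      flat_norm b (\<lambda>x. f x powr \<alpha>) \<le> ennreal (C * K powr \<alpha>)"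
    if f: "f \<in> flat_space \<beta>" and K: "enn2real (flat_norm \<beta> f) < K" for f K
  proof -
    have K0: "0 < K" using K enn2real_nonneg[of "flat_norm \<beta> f"] by linarith
    define F where "F = (\<lambda>j x. deriv_within {0..1} j f x / K)"
    have F: "unit_flat_jet \<beta> F"
      unfolding F_def by (rule unit_flat_jet_of_flat_space[OF assms(3) f K])
    have F0: "F 0 x = f x / K" for x by (simp add: F_def deriv_within_def)
    have F01: "0 \<le> F 0 x" "F 0 x \<le> 1" if "x \<in> {0..1}" for x
      using F that by (auto simp: unit_flat_jet_def)
    from M[OF F] obtain G where G: "is_jet m G" "\<And>x. x \<in> {0..1} \<Longrightarrow> G 0 x = F 0 x powr \<alpha>"
      and G_le: "\<And>j x. j \<le> m \<Longrightarrow> x \<in> {0..1} \<Longrightarrow> \<bar>G j x\<bar> \<le> M * F 0 x powr ((b - real j) / \<beta>)"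
      and G_hol: "\<And>x y. x \<in> {0..1} \<Longrightarrow> y \<in> {0..1} \<Longrightarrow>
        \<bar>G m x - G m y\<bar> \<le> M * \<bar>x - y\<bar> powr (b - real m)"
      by blast
    define G' where "G' = (\<lambda>j x. K powr \<alpha> * G j x)"
    have jet: "is_jet m G'"
      using G(1) unfolding is_jet_def G'_def by (auto intro!: DERIV_cmult)
    have h: "f x powr \<alpha> = G' 0 x" if "x \<in> {0..1}" for x
      using G(2)[OF that] K0 by (simp add: G'_def F0 powr_divide)
    have "flat_norm b (\<lambda>x. f x powr \<alpha>)
        \<le> ennreal (K powr \<alpha> + K powr \<alpha> * M + K powr \<alpha> * M + M powr b * K powr \<alpha>)"
    proof (rule flat_norm_le_jet[OF b m_def jet h])
      fix x assume x: "x \<in> {0..1::real}"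
      have le1: "F 0 x powr e \<le> 1" if "0 \<le> e" for e
        using powr_mono2[OF that F01[OF x]] by simp
      show "\<bar>G' 0 x\<bar> \<le> K powr \<alpha>"
        using le1[of \<alpha>] assms(1) by (simp add: G'_def abs_mult G(2)[OF x] mult_left_le)
      have "\<bar>G m x\<bar> \<le> M * F 0 x powr ((b - real m) / \<beta>)" by (rule G_le[OF le_refl x])
      also have "\<dots> \<le> M * 1"
        using M1 mb assms(3) by (intro mult_left_mono le1) auto
      finally show "\<bar>G' m x\<bar> \<le> K powr \<alpha> * M"
        by (simp add: G'_def abs_mult mult_left_mono)
      show "\<bar>G' m x - G' m y\<bar> \<le> K powr \<alpha> * M * \<bar>x - y\<bar> powr (b - real m)" if y: "y \<in> {0..1}" for y
      proof -
        have "\<bar>G' m x - G' m y\<bar> = K powr \<alpha> * \<bar>G m x - G m y\<bar>"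
          by (simp add: G'_def abs_mult flip: right_diff_distrib)
        also have "\<dots> \<le> K powr \<alpha> * (M * \<bar>x - y\<bar> powr (b - real m))"
          by (intro mult_left_mono G_hol x y) simp
        finally show ?thesis by (simp only: mult.assoc)
      qed
      show "\<bar>G' j x\<bar> powr b \<le> (M powr b * K powr \<alpha>) ^ j * \<bar>G' 0 x\<bar> powr (b - real j)"
        if j: "1 \<le> j" "j \<le> m" for j
      proof -
        have "\<bar>G' j x\<bar> \<le> K powr \<alpha> * (M * F 0 x powr ((b - real j) / \<beta>))"
          unfolding G'_def abs_mult using G_le[OF j(2) x] by (simp add: mult_left_mono)
        then have "\<bar>G' j x\<bar> powr b \<le> (K powr \<alpha> * (M * F 0 x powr ((b - real j) / \<beta>))) powr b"
          using b by (intro powr_mono2) auto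
        also have "\<dots> = M powr b * (K powr (\<alpha> * b) * F 0 x powr ((b - real j) / \<beta> * b))"
          by (simp only: powr_mult powr_powr mult_ac)
        also have "(b - real j) / \<beta> * b = \<alpha> * (b - real j)"
          using assms(3) by (simp add: b_def)
        also have "\<alpha> * b = \<alpha> * real j + \<alpha> * (b - real j)"
          by (simp add: algebra_simps)
        also have "K powr (\<alpha> * real j + \<alpha> * (b - real j)) * F 0 x powr (\<alpha> * (b - real j))
            = (K powr \<alpha>) powr real j * (K powr \<alpha> * F 0 x powr \<alpha>) powr (b - real j)"
          by (simp only: powr_mult powr_powr powr_add mult_ac)
        also have "(K powr \<alpha>) powr real j = (K powr \<alpha>) ^ j"
          using K0 by (simp add: powr_realpow)
        also have "K powr \<alpha> * F 0 x powr \<alpha> = \<bar>G' 0 x\<bar>"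
          by (simp add: G'_def G(2)[OF x] abs_mult)
        also have "M powr b * ((K powr \<alpha>) ^ j * \<bar>G' 0 x\<bar> powr (b - real j))
            \<le> (M powr b) ^ j * ((K powr \<alpha>) ^ j * \<bar>G' 0 x\<bar> powr (b - real j))"
          using M1 b j(1) by (intro mult_right_mono self_le_power) (auto simp: ge_one_powr_ge_zero)
        finally show ?thesis by (simp add: power_mult_distrib mult.assoc)
      qed
    qed (use M1 in auto)
    also have "K powr \<alpha> + K powr \<alpha> * M + K powr \<alpha> * M + M powr b * K powr \<alpha> = C * K powr \<alpha>"
      by (simp add: C_def algebra_simps)
    finally show ?thesis
      using times_differentiable_on_jet[OF jet h] by blast
  qed
  show ?thesis
    unfolding b_def[symmetric]
  proof (intro exI[of _ C] ballI conjI)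
    fix f assume f: "f \<in> flat_space \<beta>"
    let ?N = "enn2real (flat_norm \<beta> f)" and ?h = "\<lambda>x. f x powr \<alpha>"
    show le: "holder_norm {0..1} b ?h \<le> flat_norm b ?h"
      by (simp add: flat_norm_def)
    (* The limit also covers functions of norm 0, which cannot be normalised by their norm. *)
    have "((\<lambda>K. K powr \<alpha>) \<longlongrightarrow> ?N powr \<alpha>) (at_right ?N)"
    proof (rule tendsto_powr')
      have "\<forall>\<^sub>F K in at_right ?N. ?N < K"
        by (rule eventually_at_right_less)
      then have "\<forall>\<^sub>F K in at_right ?N. 0 \<le> K"
        by eventually_elim (meson enn2real_nonneg le_less_trans less_imp_le)
      then show "?N \<noteq> 0 \<or> 0 < \<alpha> \<and> (\<forall>\<^sub>F K in at_right ?N. 0 \<le> K)"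
        using assms(1) by simp
    qed (auto intro: tendsto_ident_at)
    then have "((\<lambda>K. ennreal (C * K powr \<alpha>)) \<longlongrightarrow> ennreal (C * ?N powr \<alpha>)) (at_right ?N)"
      by (intro tendsto_ennrealI tendsto_mult_left)
    moreover have "\<forall>\<^sub>F K in at_right ?N. flat_norm b ?h \<le> ennreal (C * K powr \<alpha>)"
      using eventually_at_right_less[of ?N] by eventually_elim (use scaled[OF f] in blast)
    ultimately show bound: "flat_norm b ?h \<le> ennreal (C * ?N powr \<alpha>)"
      by (rule tendsto_lowerbound) simp
    then have fin: "flat_norm b ?h < \<infinity>"
      by (rule le_less_trans) simp
    have "times_differentiable_on m ?h {0..1}"
      using scaled[OF f, of "?N + 1"] by simp
    with fin le show "?h \<in> flat_space b"
      by (auto simp: flat_space_def holder_space_def m_def intro: le_less_trans)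
  qed
qed

end
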